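(* Let $i$ be a node of the network, let $N_i^+$ be its set of out-neighbors, let $N_i^*$ be a subset of $N_i^+$, and denote $\bar N_i^* = N_i^+\setminus N_i^*$. Let $\mathcal{C}$ be the set of measured nodes, selected by the matrix $C$. The transfer functions corresponding to the edges from $i$ to the nodes of $N_i^*$ can generically all be identified from $CT^0$ (i.e. when measuring the nodes $\mathcal{C}$) if and only if the following two conditions hold: $$ b_{N_i^*\to \mathcal{C}} = |N_i^*|, \qquad b_{N_i^+\to\mathcal{C}} = b_{N_i^*\to\mathcal{C}} + b_{\bar N_i^*\to\mathcal{C}} = |N_i^*| + b_{\bar N_i^*\to\mathcal{C}}. $$
   Context: Network. There are $L$ nodes with signals $w(t)=[w_1(t),\dots,w_L(t)]^T$ obeying $w(t)=G^0(q)w(t)+r(t)+v(t)$, where $q^{-1}$ is the delay operator, $r(t)$ is a vector of known external excitation signals (one at each node), $v(t)$ is a noise vector, and the network matrix $G^0$ is an $L\times L$ matrix with zero diagonal whose entries are proper rational transfer functions; the network is well-posed ($(I-G^0)^{-1}$ is proper and stable). $T^0=(I-G^0)^{-1}$. Topology. The topology is a known weakly connected directed graph on $\{1,\dots,L\}$ without self-loops; an edge $(j,i)$ from $j$ to $i$ corresponds to a transfer function $G_{ij}$ that is not known to be zero. A matrix $M$ is consistent with the graph if $M_{ij}\neq 0$ only if $(j,i)$ is an edge (an edge does not force $M_{ij}\ne0$). $G^0$ is consistent with its graph. $N_i^+$ is the set of nodes $j$ such that $(i,j)$ is an edge. Measurements. $y(t)=Cw(t)$, where $C$ is a $p\times L$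 matrix each row of which has one entry $1$ and all others $0$; $\mathcal{C}$ is the set of $p$ nodes selected by $C$. The matrix $CT^0$ is assumed exactly known. Generic identifiability. A rational transfer matrix parametrization consistent with the graph: for every edge $(j,i)$ fix nonnegative integers $p_{ij},n_{ij}$ and set $$G_{ij}(z)=\kappa_{ij}z^{-p_{ij}}\frac{z^{n_{ij}}+\beta_{ij}^{(n_{ij}-1)}z^{n_{ij}-1}+\dots+\beta_{ij}^{(0)}}{z^{n_{ij}}+\alpha_{ij}^{(n_{ij}-1)}z^{n_{ij}-1}+\dots+\alpha_{ij}^{(0)}}$$ with real parameters $\kappa_{ij},\alpha_{ij}^{(m)},\beta_{ij}^{(m)}$, and $G_{ij}(z)=0$ when $(j,i)$ is not an edge. All parameters are collected in $P\in\mathbb{R}^N$, and the resulting matrix is $G(P,z)$. A group of edges (or their transfer functions) is generically identifiable from $CT^0$ if for every such parametrization, for all $P$ except possibly those in a zero-measure subset of $\mathbb{R}^N$, the following holds: for every network matrix $\tilde G(z)$ consistent with the graph, $C(I-G(P,z))^{-1}=C(I-\tilde G(z))^{-1}$ implies $G_{ji}(P,z)=\tilde G_{ji}(z)$ for every edge $(i,j)$ of the group. Paths. A walk is a sequence of adjacent directed edges (including trivial walks consisting of one node and no edge). A path is a walk that never passes twice through the same node. Paths are mutually vertex disjoint if no two of them contain a common vertex (including start and end vertices). For sets of nodes $\mathcal{A},\mathcal{C}$, $b_{\mathcal{A}\to\mathcal{C}}$ is the maximum number of mutually vertex disjoint paths starting in $\mathcal{A}$ and ending in $\mathcal{C}$.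 *)

theory Defs
  imports "HOL-Analysis.Analysis" "HOL-Computational_Algebra.Computational_Algebra"
begin

section \<open>Transfer functions and network matrices\<close>

text \<open>
  A transfer function is a rational function in the shift variable \<open>z\<close> with real coefficients.
  Nodes are the elements of a finite type, and \<open>(j, i) \<in> E\<close> is the edge from \<open>j\<close> to \<open>i\<close>, whose
  transfer function is the entry \<open>G $ i $ j\<close> (row \<open>i\<close>, column \<open>j\<close>).
\<close>

type_synonym transfer_fun = "real poly fract"

definition proper_tf :: "transfer_fun \<Rightarrow> bool" where
  "proper_tf f \<longleftrightarrow> (\<exists>a b. b \<noteq> 0 \<and> f = Fract a b \<and> degree a \<le> degree b)"

text \<open>
  Stability in discrete time: every pole lies in the open unit disc. The fraction may be chosen in
  lowest terms, so cancelling roots of the denominator do not count as poles.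
\<close>

definition stable_tf :: "transfer_fun \<Rightarrow> bool" where
  "stable_tf f \<longleftrightarrow> (\<exists>a b. b \<noteq> 0 \<and> f = Fract a b \<and>
     (\<forall>z. poly (map_poly complex_of_real b) z = 0 \<longrightarrow> cmod z < 1))"

definition well_posed :: "transfer_fun ^ 'n ^ 'n \<Rightarrow> bool" where
  "well_posed G \<longleftrightarrow> invertible (mat 1 - G) \<and>
     (\<forall>i j. proper_tf (matrix_inv (mat 1 - G) $ i $ j) \<and> stable_tf (matrix_inv (mat 1 - G) $ i $ j))"

definition network_matrix :: "transfer_fun ^ 'n ^ 'n \<Rightarrow> bool" where
  "network_matrix G \<longleftrightarrow> (\<forall>i. G $ i $ i = 0) \<and> (\<forall>i j. proper_tf (G $ i $ j)) \<and> well_posed G"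

definition consistent_with :: "('n \<times> 'n) set \<Rightarrow> transfer_fun ^ 'n ^ 'n \<Rightarrow> bool" where
  "consistent_with E G \<longleftrightarrow> (\<forall>i j. G $ i $ j \<noteq> 0 \<longrightarrow> (j, i) \<in> E)"

definition weakly_connected :: "('n \<times> 'n) set \<Rightarrow> bool" where
  "weakly_connected E \<longleftrightarrow> (E \<union> E\<inverse>)\<^sup>* = UNIV"

definition selection_matrix :: "transfer_fun ^ 'n ^ 'p \<Rightarrow> bool" where
  "selection_matrix C \<longleftrightarrow> (\<forall>k. \<exists>j. C $ k = axis j 1)"

definition selected_nodes :: "transfer_fun ^ 'n ^ 'p \<Rightarrow> 'n set" where
  "selected_nodes C = {j. \<exists>k. C $ k $ j = 1}"


section \<open>Parametrizations and generic identifiability\<close>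

text \<open>
  The dimension \<open>N\<close> of the parameter space depends on the degrees chosen for the edges, so a
  parameter vector is a function on a finite index set of \<open>N\<close> names: for the edge \<open>e\<close>, \<open>Kappa e\<close>
  is the gain, and \<open>Alpha e m\<close> and \<open>Beta e m\<close> are the coefficients of \<open>z ^ m\<close> in the denominator
  and in the numerator.
\<close>

datatype 'n param = Kappa "'n \<times> 'n" | Alpha "'n \<times> 'n" nat | Beta "'n \<times> 'n" nat

definition param_indices :: "('n \<times> 'n) set \<Rightarrow> ('n \<times> 'n \<Rightarrow> nat) \<Rightarrow> 'n param set" where
  "param_indices E n =
     Kappa ` E \<union> {Alpha e m |e m. e \<in> E \<and> m < n e} \<union> {Beta e m |e m. e \<in> E \<and> m < n e}"

definition param_measure ::
    "('n \<times> 'n) set \<Rightarrow> ('n \<times> 'n \<Rightarrow> nat) \<Rightarrow> ('n param \<Rightarrow> real) measure" where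
  "param_measure E n = PiM (param_indices E n) (\<lambda>_. lborel)"

definition monic_poly :: "nat \<Rightarrow> (nat \<Rightarrow> real) \<Rightarrow> real poly" where
  "monic_poly n c = monom 1 n + (\<Sum>m<n. monom (c m) m)"

definition param_matrix ::
    "('n \<times> 'n) set \<Rightarrow> ('n \<times> 'n \<Rightarrow> nat) \<Rightarrow> ('n \<times> 'n \<Rightarrow> nat) \<Rightarrow> ('n param \<Rightarrow> real) \<Rightarrow>
      transfer_fun ^ 'n ^ 'n" where
  "param_matrix E d n P = (\<chi> i j.
     if (j, i) \<in> E then
       Fract (smult (P (Kappa (j, i))) (monic_poly (n (j, i)) (\<lambda>m. P (Beta (j, i) m))))
             (monom 1 (d (j, i)) * monic_poly (n (j, i)) (\<lambda>m. P (Alpha (j, i) m)))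
     else 0)"

text \<open>
  Generic identifiability of the group \<open>F\<close> of edges from \<open>C (I - G)\<^sup>-\<^sup>1\<close>. The value of
  \<^const>\<open>matrix_inv\<close> at a singular \<open>I - G(P)\<close> is immaterial: its determinant is, up to a nonzero
  denominator, a polynomial in the parameters that equals \<open>1\<close> when all gains vanish, so it is
  singular only for \<open>P\<close> in a null set.
\<close>

definition generically_identifiable ::
    "('n::finite \<times> 'n) set \<Rightarrow> transfer_fun ^ 'n ^ 'p \<Rightarrow> ('n \<times> 'n) set \<Rightarrow> bool" where
  "generically_identifiable E C F \<longleftrightarrow>
     (\<forall>d n. AE P in param_measure E n.
        \<forall>G'. network_matrix G' \<and> consistent_with E G' \<and>
             C ** matrix_inv (mat 1 - param_matrix E d n P) = C ** matrix_inv (mat 1 - G') \<longrightarrow>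
             (\<forall>(j, i) \<in> F. param_matrix E d n P $ i $ j = G' $ i $ j))"


section \<open>Vertex disjoint paths\<close>

text \<open>A path is given by its list of nodes; a one-element list is a trivial path.\<close>

definition digraph_path :: "('n \<times> 'n) set \<Rightarrow> 'n list \<Rightarrow> bool" where
  "digraph_path E xs \<longleftrightarrow> xs \<noteq> [] \<and> successively (\<lambda>u v. (u, v) \<in> E) xs \<and> distinct xs"

definition paths_between :: "('n \<times> 'n) set \<Rightarrow> 'n set \<Rightarrow> 'n set \<Rightarrow> 'n list set" where
  "paths_between E A B = {xs. digraph_path E xs \<and> hd xs \<in> A \<and> last xs \<in> B}"

definition max_disjoint_paths :: "('n::finite \<times> 'n) set \<Rightarrow> 'n set \<Rightarrow> 'n set \<Rightarrow> nat" where
  "max_disjoint_paths E A B =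
     Max {card Q |Q. Q \<subseteq> paths_between E A B \<and> pairwise (\<lambda>xs ys. disjnt (set xs) (set ys)) Q}"

text \<open>
  Over a finite node type there are finitely many paths, so the maximum above is taken over a
  finite nonempty set of cardinalities of finite sets.
\<close>

lemma finite_paths_between: "finite (paths_between E A (B :: 'n::finite set))"
proof (rule finite_subset)
  show "paths_between E A B \<subseteq> {xs. set xs \<subseteq> UNIV \<and> length xs \<le> CARD('n)}"
    by (auto simp: paths_between_def digraph_path_def)
       (metis card_mono distinct_card finite subset_UNIV)
  show "finite {xs :: 'n list. set xs \<subseteq> UNIV \<and> length xs \<le> CARD('n)}"
    by (rule finite_lists_length_le) simp
qed

end

theory Submission imports Defs begin

text \<open>
  If \<open>C T = C T'\<close> then \<open>C T (G - G') = 0\<close>; conversely, a vector \<open>x\<close> supported on \<open>N\<^sub>i\<^sup>+\<close> with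
  \<open>C T x = 0\<close> can be added, suitably scaled, to column \<open>i\<close> of \<open>G\<close> without changing \<open>C T\<close>. Hence
  the edges to \<open>N\<^sub>i\<^sup>*\<close> are identifiable iff the corresponding columns of \<open>C T\<close> are independent of each
  other and of the columns of the remaining out-neighbours. Generically, a set of columns of \<open>C T\<close> is
  independent iff its nodes are linked to the measured nodes by disjoint paths. Independence
  is full column rank of a submatrix of \<open>I - G\<close>, and yields a transversal of nonzero entries whose
  orbits are such paths. For given paths, suitable gains make a polynomial in the
  parameters nonzero, and the zero set of that polynomial is null.

  For the necessity it suffices to consider constant transfer functions, for which properness and
  stability hold automatically.
\<close>

section \<open>Linked sets\<close>

text \<open>Paths are indexed by their start nodes: what matters later is which start nodes can be
  served simultaneously, not only how many.\<close>

definition linked :: "('n \<times> 'n) set \<Rightarrow> 'n set \<Rightarrow> 'n set \<Rightarrow> bool" where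
  "linked E A B \<longleftrightarrow> (\<exists>p. (\<forall>a\<in>A. p a \<in> paths_between E {a} B) \<and>
     (\<forall>a\<in>A. \<forall>b\<in>A. a \<noteq> b \<longrightarrow> disjnt (set (p a)) (set (p b))))"

lemma linked_subset:
  assumes "linked E A B" "A' \<subseteq> A"
  shows "linked E A' B"
proof -
  obtain p where "\<forall>a\<in>A. p a \<in> paths_between E {a} B"
    "\<forall>a\<in>A. \<forall>b\<in>A. a \<noteq> b \<longrightarrow> disjnt (set (p a)) (set (p b))"
    using assms(1) unfolding linked_def by (elim exE conjE)
  then show ?thesis
    unfolding linked_def using assms(2) by (intro exI[of _ p]) (simp add: subset_iff)
qed

lemma finite_disjoint_path_counts:
  fixes E :: "('n::finite \<times> 'n) set"
  shows "finite {card Q |Q. Q \<subseteq> paths_between E A B \<and> pairwise (\<lambda>xs ys. disjnt (set xs) (set ys)) Q}"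
  by (rule finite_subset[of _ "card ` Pow (paths_between E A B)"]) (auto simp: finite_paths_between)

text \<open>Distinct start nodes make \<open>p\<close> injective, so its image is a disjoint family
  with \<open>card A'\<close> members.\<close>

lemma card_le_max_disjoint_paths:
  fixes E :: "('n::finite \<times> 'n) set"
  assumes "linked E A' B" "A' \<subseteq> A"
  shows "card A' \<le> max_disjoint_paths E A B"
proof -
  obtain p where p: "\<forall>a\<in>A'. p a \<in> paths_between E {a} B"
    "\<forall>a\<in>A'. \<forall>b\<in>A'. a \<noteq> b \<longrightarrow> disjnt (set (p a)) (set (p b))"
    using assms(1) unfolding linked_def by (elim exE conjE)
  have hd: "hd (p a) = a" if "a \<in> A'" for a
    using p(1) that by (simp add: paths_between_def)
  then have "inj_on p A'"
    by (metis inj_onI)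
  moreover have "p ` A' \<subseteq> paths_between E A B"
    using p(1) assms(2) by (auto simp: paths_between_def)
  moreover have "pairwise (\<lambda>xs ys. disjnt (set xs) (set ys)) (p ` A')"
    using p(2) by (auto simp: pairwise_def)
  ultimately show ?thesis
    unfolding max_disjoint_paths_def
    by (intro Max_ge[OF finite_disjoint_path_counts]) (auto simp: card_image intro!: exI[of _ "p ` A'"])
qed

text \<open>Disjoint paths have different first nodes, so a maximum family can be indexed by its
  start nodes.\<close>

lemma ex_linked_card_eq_max_disjoint_paths:
  fixes E :: "('n::finite \<times> 'n) set"
  obtains A' where "A' \<subseteq> A" "linked E A' B" "card A' = max_disjoint_paths E A B"
proof -
  have "max_disjoint_paths E A B \<in>
      {card Q |Q. Q \<subseteq> paths_between E A B \<and> pairwise (\<lambda>xs ys. disjnt (set xs) (set ys)) Q}"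
    unfolding max_disjoint_paths_def
    by (intro Max_in[OF finite_disjoint_path_counts]) (auto intro!: exI[of _ "{}"])
  then obtain Q where Q: "Q \<subseteq> paths_between E A B"
      "pairwise (\<lambda>xs ys. disjnt (set xs) (set ys)) Q" "max_disjoint_paths E A B = card Q"
    by blast
  have ne: "xs \<noteq> []" if "xs \<in> Q" for xs
    using Q(1) that by (auto simp: paths_between_def digraph_path_def)
  have inj: "inj_on hd Q"
  proof (rule inj_onI)
    fix xs ys assume *: "xs \<in> Q" "ys \<in> Q" "hd xs = hd ys"
    then have "\<not> disjnt (set xs) (set ys)"
      using ne by (metis disjnt_iff hd_in_set)
    then show "xs = ys"
      using Q(2) * by (auto simp: pairwise_def)
  qed
  have "linked E (hd ` Q) B"
    unfolding linked_def
  proof (intro exI[of _ "inv_into Q hd"] conjI ballI impI)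
    fix a assume a: "a \<in> hd ` Q"
    then have "inv_into Q hd a \<in> Q" "hd (inv_into Q hd a) = a"
      by (simp_all add: inv_into_into f_inv_into_f)
    then show "inv_into Q hd a \<in> paths_between E {a} B"
      using Q(1) by (auto simp: paths_between_def)
  next
    fix a b assume ab: "a \<in> hd ` Q" "b \<in> hd ` Q" "a \<noteq> b"
    then have "inv_into Q hd a \<noteq> inv_into Q hd b"
      by (metis f_inv_into_f)
    then show "disjnt (set (inv_into Q hd a)) (set (inv_into Q hd b))"
      using Q(2) ab by (simp add: pairwise_def inv_into_into)
  qed
  moreover have "hd ` Q \<subseteq> A"
    using Q(1) by (auto simp: paths_between_def)
  ultimately show ?thesis
    using that inj Q(3) by (simp add: card_image)
qed

text \<open>The start nodes of a maximum family from \<open>A\<close> split into at most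
  \<open>card S\<close> in \<open>S\<close> and at most
  \<open>max_disjoint_paths E (A - S) B\<close> outside. Equality of the totals forces both bounds
  to be attained.\<close>

lemma ex_linked_extension:
  fixes E :: "('n::finite \<times> 'n) set"
  assumes "S \<subseteq> A" "max_disjoint_paths E A B = card S + max_disjoint_paths E (A - S) B"
  obtains R where "R \<subseteq> A - S" "card R = max_disjoint_paths E (A - S) B" "linked E (S \<union> R) B"
proof -
  obtain A' where A': "A' \<subseteq> A" "linked E A' B" "card A' = max_disjoint_paths E A B"
    by (rule ex_linked_card_eq_max_disjoint_paths)
  have split: "card A' = card (A' \<inter> S) + card (A' - S)"
    using card_Int_Diff by (metis finite)
  have R: "card (A' - S) \<le> max_disjoint_paths E (A - S) B"
    by (intro card_le_max_disjoint_paths linked_subset[OF A'(2)]) (use A'(1) in auto)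
  have "card (A' \<inter> S) \<le> card S"
    by (simp add: card_mono)
  then have "card (A' \<inter> S) = card S" "card (A' - S) = max_disjoint_paths E (A - S) B"
    using split R A'(3) assms(2) by linarith+
  moreover from this have "S \<union> (A' - S) = A'"
    using card_subset_eq[of S "A' \<inter> S"] by auto
  ultimately show ?thesis
    using that[of "A' - S"] A' by auto
qed

text \<open>The same split bounds every family from \<open>A\<close>; the paths from
  \<open>S \<union> R\<close> attain the bound.\<close>

lemma max_disjoint_paths_of_linked_extension:
  fixes E :: "('n::finite \<times> 'n) set"
  assumes "S \<subseteq> A" "R \<subseteq> A - S" "card R = max_disjoint_paths E (A - S) B" "linked E (S \<union> R) B"
  shows "max_disjoint_paths E S B = card S"
    and "max_disjoint_paths E A B = card S + max_disjoint_paths E (A - S) B"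
proof -
  obtain S' where "S' \<subseteq> S" "linked E S' B" "card S' = max_disjoint_paths E S B"
    by (rule ex_linked_card_eq_max_disjoint_paths)
  then have "max_disjoint_paths E S B \<le> card S"
    by (metis card_mono finite)
  moreover have "card S \<le> max_disjoint_paths E S B"
    by (intro card_le_max_disjoint_paths linked_subset[OF assms(4)]) auto
  ultimately show "max_disjoint_paths E S B = card S"
    by simp
  obtain A' where A': "A' \<subseteq> A" "linked E A' B" "card A' = max_disjoint_paths E A B"
    by (rule ex_linked_card_eq_max_disjoint_paths)
  have "card A' = card (A' \<inter> S) + card (A' - S)"
    using card_Int_Diff by (metis finite)
  moreover have "card (A' - S) \<le> max_disjoint_paths E (A - S) B"
    by (intro card_le_max_disjoint_paths linked_subset[OF A'(2)]) (use A'(1) in auto)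
  moreover have "card (A' \<inter> S) \<le> card S"
    by (simp add: card_mono)
  moreover have "card (S \<union> R) \<le> max_disjoint_paths E A B"
    using assms by (intro card_le_max_disjoint_paths) auto
  moreover have "card (S \<union> R) = card S + card R"
    using assms(2) by (intro card_Un_disjoint) auto
  ultimately show "max_disjoint_paths E A B = card S + max_disjoint_paths E (A - S) B"
    using A'(3) assms(3) by linarith
qed

section \<open>Independent columns and linked sets\<close>

text \<open>Rectangular analogue of the fact that a nonzero determinant has a nonzero Leibniz term.
  The induction deletes column \<open>j\<close> together with a row \<open>i\<close> such that
  \<open>M i j\<close> is nonzero and the remaining columns stay independent.\<close>

lemma independent_columns_transversal:
  fixes M :: "'i \<Rightarrow> 'j \<Rightarrow> 'a::field"
  assumes "finite J" "finite I"
    and "\<And>y. (\<forall>i\<in>I. (\<Sum>j\<in>J. M i j * y j) = 0) \<Longrightarrow> (\<forall>j\<in>J. y j = 0)"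
  shows "\<exists>\<sigma>. inj_on \<sigma> J \<and> \<sigma> ` J \<subseteq> I \<and> (\<forall>j\<in>J. M (\<sigma> j) j \<noteq> 0)"
  using assms
proof (induction J arbitrary: I rule: finite_induct)
  case (insert j J)
  have sum_insert: "(\<Sum>l\<in>insert j J. M k l * y l) = M k j * y j + (\<Sum>l\<in>J. M k l * y l)" for k y
    using insert.hyps by simp
  have indep: "\<forall>l\<in>J. y l = 0" if "\<forall>i\<in>I. (\<Sum>l\<in>J. M i l * y l) = 0" for y
  proof -
    have "(\<Sum>l\<in>J. M i l * (y(j := 0)) l) = (\<Sum>l\<in>J. M i l * y l)" for i
      using insert.hyps by (intro sum.cong) auto
    then have "\<forall>l\<in>insert j J. (y(j := 0)) l = 0"
      using that by (intro insert.prems(2)) (simp add: sum_insert del: fun_upd_apply, simp)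
    then show ?thesis
      using insert.hyps by (metis fun_upd_other insertI2)
  qed
  \<comment> \<open>Otherwise every unit vector \<open>e\<^sub>i\<close> with \<open>M i j \<noteq> 0\<close> lies in the span of the columns in
    \<open>J\<close>, and hence so does column \<open>j\<close>.\<close>
  have "\<exists>i\<in>I. M i j \<noteq> 0 \<and>
      (\<forall>y. (\<forall>k\<in>I - {i}. (\<Sum>l\<in>J. M k l * y l) = 0) \<longrightarrow> (\<forall>l\<in>J. y l = 0))"
  proof (rule ccontr)
    assume neg: "\<not> ?thesis"
    have "\<exists>y. \<forall>k\<in>I. (\<Sum>l\<in>J. M k l * y l) = (if k = i then 1 else 0)" if i: "i \<in> I" "M i j \<noteq> 0" for i
    proof -
      \<comment> \<open>By \<open>indep\<close> this relation must fail in row \<open>i\<close>;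
        dividing by its value there produces the unit vector.\<close>
      obtain y l where y: "\<forall>k\<in>I - {i}. (\<Sum>l\<in>J. M k l * y l) = 0" "l \<in> J" "y l \<noteq> 0"
        using neg i by blast
      define c where "c = (\<Sum>l\<in>J. M i l * y l)"
      have "c \<noteq> 0"
        using indep[of y] y unfolding c_def by blast
      moreover have "(\<Sum>l\<in>J. M k l * (y l / c)) = (\<Sum>l\<in>J. M k l * y l) / c" for k
        by (simp add: sum_divide_distrib)
      ultimately show ?thesis
        using y by (intro exI[of _ "\<lambda>l. y l / c"]) (auto simp: c_def)
    qed
    then obtain w where w: "\<And>i k. i \<in> I \<Longrightarrow> M i j \<noteq> 0 \<Longrightarrow> k \<in> I \<Longrightarrow>
        (\<Sum>l\<in>J. M k l * w i l) = (if k = i then 1 else 0)"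
      by metis
    \<comment> \<open>A relation with coefficient \<open>-1\<close> at \<open>j\<close>: column
      \<open>j\<close> is the sum over \<open>i\<close> of \<open>M i j\<close> times the
      \<open>i\<close>-th unit vector.\<close>
    define z where "z l = (if l = j then -1 else \<Sum>i\<in>I. M i j * w i l)" for l
    have "(\<Sum>l\<in>insert j J. M k l * z l) = 0" if k: "k \<in> I" for k
    proof -
      have "(\<Sum>l\<in>J. M k l * z l) = (\<Sum>l\<in>J. \<Sum>i\<in>I. M i j * (M k l * w i l))"
        using insert.hyps by (intro sum.cong) (auto simp: z_def sum_distrib_left algebra_simps)
      also have "\<dots> = (\<Sum>i\<in>I. M i j * (\<Sum>l\<in>J. M k l * w i l))"
        by (subst sum.swap) (simp add: sum_distrib_left)
      also have "\<dots> = (\<Sum>i\<in>I. if k = i then M k j else 0)"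
        by (intro sum.cong refl) (use w k in force)
      also have "\<dots> = M k j"
        using k insert.prems(1) by simp
      finally show ?thesis
        unfolding sum_insert by (simp add: z_def)
    qed
    then have "z j = 0"
      using insert.prems(2) by blast
    then show False
      by (simp add: z_def)
  qed
  then obtain i where i: "i \<in> I" "M i j \<noteq> 0"
    and ind: "\<And>y. (\<forall>k\<in>I - {i}. (\<Sum>l\<in>J. M k l * y l) = 0) \<Longrightarrow> (\<forall>l\<in>J. y l = 0)"
    by blast
  obtain \<sigma> where \<sigma>: "inj_on \<sigma> J" "\<sigma> ` J \<subseteq> I - {i}" "\<forall>l\<in>J. M (\<sigma> l) l \<noteq> 0"
    using insert.IH[OF _ ind] insert.prems(1) by blast
  have "inj_on (\<sigma>(j := i)) (insert j J)"
    using \<sigma>(1,2) insert.hyps by (auto simp: inj_on_def)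
  moreover have "(\<sigma>(j := i)) ` insert j J \<subseteq> I" "\<forall>l\<in>insert j J. M ((\<sigma>(j := i)) l) l \<noteq> 0"
    using \<sigma>(2,3) i insert.hyps by auto
  ultimately show ?case
    by blast
qed simp

text \<open>
  For invertible \<open>M\<close> the substitution \<open>y = M\<^sup>-\<^sup>1 x\<close> turns this into: the columns with index
  in \<open>A\<close> of the matrix formed by the rows of \<open>M\<^sup>-\<^sup>1\<close> with index in \<open>B\<close> are linearly independent.
\<close>

definition independent_columns :: "'a::field ^ 'n ^ 'n \<Rightarrow> 'n set \<Rightarrow> 'n set \<Rightarrow> bool" where
  "independent_columns M A B \<longleftrightarrow>
     (\<forall>y. (\<forall>j\<in>B. y $ j = 0) \<and> (\<forall>u. u \<notin> A \<longrightarrow> (M *v y) $ u = 0) \<longrightarrow> y = 0)"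

text \<open>
  The orbits of \<open>\<sigma>\<close> that start in \<open>A\<close> never return to \<open>A\<close>; injectivity makes them disjoint
  paths, which can only stop in \<open>B\<close>.
\<close>

lemma linked_if_transversal:
  fixes \<sigma> :: "'n::finite \<Rightarrow> 'n"
  assumes inj: "inj_on \<sigma> (- B)" and avoid: "\<sigma> ` (- B) \<subseteq> - A"
    and edge: "\<And>v. v \<notin> B \<Longrightarrow> \<sigma> v = v \<or> (v, \<sigma> v) \<in> E"
  shows "linked E A B"
proof -
  \<comment> \<open>Two orbits that meet can be traced back by injectivity off \<open>B\<close>. If
    one is exhausted first, its start node in \<open>A\<close> would be a value of
    \<open>\<sigma>\<close> off \<open>B\<close>, against \<open>avoid\<close>.\<close>
  have unique: "k = l \<and> a = b"
    if "a \<in> A" "b \<in> A" "\<forall>i<k. (\<sigma> ^^ i) a \<notin> B" "\<forall>i<l. (\<sigma> ^^ i) b \<notin> B" "(\<sigma> ^^ k) a = (\<sigma> ^^ l) b"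
    for a b k l
    using that(3-)
  proof (induction k arbitrary: l)
    case 0
    show ?case
    proof (cases l)
      case (Suc l')
      then have "(\<sigma> ^^ l') b \<notin> B" "a = \<sigma> ((\<sigma> ^^ l') b)"
        using 0 by auto
      then show ?thesis
        using avoid that(1) by blast
    qed (use 0 in simp)
  next
    case (Suc k)
    have k: "(\<sigma> ^^ k) a \<notin> B"
      using Suc.prems(1) by simp
    show ?case
    proof (cases l)
      case 0
      then show ?thesis
        using Suc.prems(3) k avoid that(2) by auto
    next
      case (Suc l')
      then have "(\<sigma> ^^ k) a = (\<sigma> ^^ l') b"
        using Suc.prems(2,3) k inj_onD[OF inj] by simp
      then show ?thesis
        using Suc.IH[of l'] Suc.prems(1,2) \<open>l = Suc l'\<close> by simp
    qed
  qed
  \<comment> \<open>An orbit avoiding \<open>B\<close> forever would consist of infinitely many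
    distinct nodes.\<close>
  have reach: "\<exists>k. (\<sigma> ^^ k) a \<in> B" if "a \<in> A" for a
  proof (rule ccontr)
    assume "\<not> ?thesis"
    then have "k = l" if "(\<sigma> ^^ k) a = (\<sigma> ^^ l) a" for k l
      using unique[OF \<open>a \<in> A\<close> \<open>a \<in> A\<close>, of k l] that by blast
    then have "inj (\<lambda>k. (\<sigma> ^^ k) a)"
      by (rule injI)
    then show False
      using finite_imageD[of "\<lambda>k. (\<sigma> ^^ k) a" UNIV] by simp
  qed
  \<comment> \<open>The path stops at the first visit to \<open>B\<close>; it is trivial when
    \<open>a\<close> already lies in \<open>B\<close>.\<close>
  define len where "len a = (LEAST k. (\<sigma> ^^ k) a \<in> B)" for a
  have len: "(\<sigma> ^^ len a) a \<in> B" if "a \<in> A" for a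
    using LeastI_ex[OF reach[OF that]] unfolding len_def .
  have before: "(\<sigma> ^^ k) a \<notin> B" if "k < len a" for a k
    using not_less_Least that unfolding len_def by blast
  then have upto: "\<forall>i<k. (\<sigma> ^^ i) a \<notin> B" if "k \<le> len a" for a k
    using that by simp
  define p where "p a = map (\<lambda>k. (\<sigma> ^^ k) a) [0..<Suc (len a)]" for a
  have set_p: "set (p a) = (\<lambda>k. (\<sigma> ^^ k) a) ` {..len a}" for a
    by (auto simp: p_def simp del: upt_Suc)
  \<comment> \<open>Fixed points of \<open>\<sigma>\<close>, which come from diagonal entries,
    cannot occur on these orbits: \<open>unique\<close> would identify two different step
    numbers.\<close>
  have step: "((\<sigma> ^^ k) a, (\<sigma> ^^ Suc k) a) \<in> E" if "a \<in> A" "k < len a" for a k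
  proof -
    have "\<forall>i<Suc k. (\<sigma> ^^ i) a \<notin> B" "\<forall>i<k. (\<sigma> ^^ i) a \<notin> B"
      using upto[OF Suc_leI] upto[OF less_imp_le] that(2) by blast+
    then have "(\<sigma> ^^ Suc k) a \<noteq> (\<sigma> ^^ k) a"
      using unique[OF that(1,1), of "Suc k" k] by (metis n_not_Suc_n)
    then show ?thesis
      using edge[OF before[OF that(2)]] by auto
  qed
  have "p a \<in> paths_between E {a} B" if a: "a \<in> A" for a
  proof -
    have "distinct (p a)"
      unfolding p_def distinct_map
    proof (intro conjI inj_onI)
      fix k l assume "k \<in> set [0..<Suc (len a)]" "l \<in> set [0..<Suc (len a)]"
        "(\<sigma> ^^ k) a = (\<sigma> ^^ l) a"
      then show "k = l"
        using unique[OF a a upto upto, of k l] by auto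
    qed simp
    moreover have "successively (\<lambda>u v. (u, v) \<in> E) (p a)"
      unfolding successively_conv_nth using step[OF a] by (auto simp: p_def simp del: upt_Suc)
    moreover have "hd (p a) = a"
      by (simp add: p_def hd_map del: upt_Suc)
    moreover have "last (p a) = (\<sigma> ^^ len a) a" "p a \<noteq> []"
      by (simp_all add: p_def)
    ultimately show ?thesis
      using len[OF a] by (simp add: paths_between_def digraph_path_def)
  qed
  moreover have "disjnt (set (p a)) (set (p b))" if ab: "a \<in> A" "b \<in> A" "a \<noteq> b" for a b
  proof -
    have "(\<sigma> ^^ k) a \<noteq> (\<sigma> ^^ l) b" if "k \<le> len a" "l \<le> len b" for k l
      using unique[OF ab(1,2) upto upto, of k l] ab(3) that by blast
    then show ?thesis
      by (auto simp: disjnt_iff set_p)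
  qed
  ultimately show ?thesis
    unfolding linked_def by (intro exI[of _ p]) simp
qed

text \<open>Independence means that the columns of \<open>M\<close> outside \<open>B\<close>,
  restricted to the rows outside \<open>A\<close>, are independent. Their transversal maps each node
  outside \<open>B\<close> to itself or along an edge.\<close>

lemma linked_if_independent_columns:
  fixes M :: "'a::field ^ 'n ^ 'n::finite"
  assumes "independent_columns M A B"
    and pattern: "\<And>u v. M $ u $ v \<noteq> 0 \<Longrightarrow> u = v \<or> (v, u) \<in> E"
  shows "linked E A B"
proof -
  have "\<forall>v\<in>- B. y v = 0" if y: "\<forall>u\<in>- A. (\<Sum>v\<in>- B. M $ u $ v * y v) = 0" for y
  proof -
    define y' where "y' = (\<chi> v. if v \<in> B then 0 else y v)"
    have "(M *v y') $ u = (\<Sum>v\<in>- B. M $ u $ v * y v)" for u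
      unfolding matrix_vector_mult_def y'_def
      by (simp, rule sum.mono_neutral_cong_right) auto
    then have "y' = 0"
      using assms(1) y unfolding independent_columns_def by (auto simp: y'_def)
    then show ?thesis
      by (auto simp: y'_def vec_eq_iff split: if_splits)
  qed
  then obtain \<sigma> where "inj_on \<sigma> (- B)" "\<sigma> ` (- B) \<subseteq> - A" "\<forall>v\<in>- B. M $ (\<sigma> v) $ v \<noteq> 0"
    using independent_columns_transversal[of "- B" "- A" "\<lambda>u v. M $ u $ v"] by auto
  then show ?thesis
    using pattern by (intro linked_if_transversal[of \<sigma>]) blast+
qed

section \<open>Zero sets of polynomial functions\<close>

text \<open>Real polynomial functions in the coordinates from \<open>I\<close>, generated so that
  closure properties and measurability follow by rule induction.\<close>

inductive_set poly_funs :: "'i set \<Rightarrow> (('i \<Rightarrow> real) \<Rightarrow> real) set" for I where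
  const: "(\<lambda>_. c) \<in> poly_funs I"
| coord: "i \<in> I \<Longrightarrow> (\<lambda>x. x i) \<in> poly_funs I"
| add: "f \<in> poly_funs I \<Longrightarrow> g \<in> poly_funs I \<Longrightarrow> (\<lambda>x. f x + g x) \<in> poly_funs I"
| mult: "f \<in> poly_funs I \<Longrightarrow> g \<in> poly_funs I \<Longrightarrow> (\<lambda>x. f x * g x) \<in> poly_funs I"

lemma poly_funs_sum: "(\<And>s. s \<in> S \<Longrightarrow> f s \<in> poly_funs I) \<Longrightarrow> (\<lambda>x. \<Sum>s\<in>S. f s x) \<in> poly_funs I"
  by (induction S rule: infinite_finite_induct) (auto intro: poly_funs.intros)

lemma poly_funs_prod: "(\<And>s. s \<in> S \<Longrightarrow> f s \<in> poly_funs I) \<Longrightarrow> (\<lambda>x. \<Prod>s\<in>S. f s x) \<in> poly_funs I"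
  by (induction S rule: infinite_finite_induct) (auto intro: poly_funs.intros)

lemma poly_funs_diff:
  assumes "f \<in> poly_funs I" "g \<in> poly_funs I"
  shows "(\<lambda>x. f x - g x) \<in> poly_funs I"
  using poly_funs.add[OF assms(1) poly_funs.mult[OF poly_funs.const[of "-1"] assms(2)]] by simp

lemma poly_funs_det:
  fixes M :: "('i \<Rightarrow> real) \<Rightarrow> real ^ 'n ^ 'n"
  assumes "\<And>u v. (\<lambda>x. M x $ u $ v) \<in> poly_funs I"
  shows "(\<lambda>x. det (M x)) \<in> poly_funs I"
  unfolding det_def by (intro poly_funs_sum poly_funs_prod poly_funs.mult poly_funs.const assms)

lemma measurable_poly_funs:
  "f \<in> poly_funs I \<Longrightarrow> f \<in> borel_measurable (PiM I (\<lambda>_. lborel))"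
proof (induction rule: poly_funs.induct)
  case (coord i)
  then show ?case
    using measurable_component_singleton[of i I "\<lambda>_. lborel :: real measure"] by simp
qed auto

text \<open>With the other coordinates frozen, \<open>f\<close> is a univariate polynomial in
  coordinate \<open>i\<close>; its coefficients are again polynomial functions, which feeds the
  induction on \<open>I\<close>.\<close>

lemma poly_funs_insert_poly:
  assumes "f \<in> poly_funs (insert i I)" "i \<notin> I"
  shows "\<exists>q. (\<forall>x t. f (x(i := t)) = poly (q x) t) \<and> (\<forall>m. (\<lambda>x. coeff (q x) m) \<in> poly_funs I)"
  using assms(1)
proof (induction rule: poly_funs.induct)
  case (const c)
  show ?case
    by (rule exI[of _ "\<lambda>_. [:c:]"]) (simp add: poly_funs.const)
next
  case (coord j)
  show ?case
  proof (cases "j = i")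
    case True
    then show ?thesis
      by (intro exI[of _ "\<lambda>_. [:0, 1:]"]) (simp add: poly_funs.const)
  next
    case False
    have "(\<lambda>x. coeff [:x j:] m) \<in> poly_funs I" for m
      using coord False by (cases m) (auto intro: poly_funs.intros)
    then show ?thesis
      using False by (intro exI[of _ "\<lambda>x. [:x j:]"]) simp
  qed
next
  case (add f g)
  then obtain q r where "\<forall>x t. f (x(i := t)) = poly (q x) t" "\<forall>m. (\<lambda>x. coeff (q x) m) \<in> poly_funs I"
    "\<forall>x t. g (x(i := t)) = poly (r x) t" "\<forall>m. (\<lambda>x. coeff (r x) m) \<in> poly_funs I"
    by (elim exE conjE)
  then show ?case
    by (intro exI[of _ "\<lambda>x. q x + r x"]) (simp add: poly_funs.add del: fun_upd_apply)
next
  case (mult f g)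
  then obtain q r where "\<forall>x t. f (x(i := t)) = poly (q x) t" "\<forall>m. (\<lambda>x. coeff (q x) m) \<in> poly_funs I"
    "\<forall>x t. g (x(i := t)) = poly (r x) t" "\<forall>m. (\<lambda>x. coeff (r x) m) \<in> poly_funs I"
    by (elim exE conjE)
  then show ?case
    by (intro exI[of _ "\<lambda>x. q x * r x"]) (simp add: coeff_mult poly_funs_sum poly_funs.mult del: fun_upd_apply)
qed

text \<open>Fubini: some coefficient of the polynomial in coordinate \<open>i\<close> is nonzero at
  \<open>x0\<close>, hence almost everywhere by induction, and then almost every fibre has only
  finitely many zeros.\<close>

lemma AE_poly_funs_nonzero:
  assumes "finite I" "f \<in> poly_funs I" "f x0 \<noteq> 0"
  shows "AE x in PiM I (\<lambda>_. lborel). f x \<noteq> 0"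
  using assms
proof (induction I arbitrary: f rule: finite_induct)
  case empty
  from empty.prems(1) have "f x = f y" for x y
    by (induction rule: poly_funs.induct) (simp, blast, metis, metis)
  then have "f x \<noteq> 0" for x
    using empty.prems(2) by metis
  then show ?case
    by simp
next
  case (insert i I)
  let ?M = "\<lambda>_. lborel :: real measure"
  interpret product_sigma_finite ?M
    by standard
  obtain q where q: "\<forall>x t. f (x(i := t)) = poly (q x) t" "\<forall>m. (\<lambda>x. coeff (q x) m) \<in> poly_funs I"
    using poly_funs_insert_poly[OF insert.prems(1) insert.hyps(2)] by blast
  have "q x0 \<noteq> 0"
    using insert.prems(2) q(1) fun_upd_triv[of x0 i] by (metis poly_0)
  then obtain m where "coeff (q x0) m \<noteq> 0"
    by (metis leading_coeff_0_iff)
  then have AE: "AE x in PiM I ?M. coeff (q x) m \<noteq> 0"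
    using insert.IH q(2) by blast
  have [measurable]: "f \<in> borel_measurable (PiM (insert i I) ?M)"
    by (rule measurable_poly_funs[OF insert.prems(1)])
  let ?Z = "{x \<in> space (PiM (insert i I) ?M). f x = 0}"
  have Z: "?Z \<in> sets (PiM (insert i I) ?M)"
    by measurable
  have "emeasure (PiM (insert i I) ?M) ?Z = (\<integral>\<^sup>+ x. indicator ?Z x \<partial>PiM (insert i I) ?M)"
    using Z by simp
  also have "\<dots> = (\<integral>\<^sup>+ x. (\<integral>\<^sup>+ t. indicator ?Z (x(i := t)) \<partial>lborel) \<partial>PiM I ?M)"
    using insert.hyps Z by (intro product_nn_integral_insert) auto
  also have "\<dots> = (\<integral>\<^sup>+ x. 0 \<partial>PiM I ?M)"
  proof (rule nn_integral_cong_AE, use AE in \<open>elim eventually_mono\<close>)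
    fix x assume "coeff (q x) m \<noteq> 0"
    then have "finite {t. poly (q x) t = 0}"
      by (intro poly_roots_finite) auto
    then have "AE t in lborel. poly (q x) t \<noteq> 0"
      by (intro AE_I'[OF finite_imp_null_set_lborel]) auto
    then have "(\<integral>\<^sup>+ t. indicator ?Z (x(i := t)) \<partial>lborel) = (\<integral>\<^sup>+ t. 0 \<partial>(lborel :: real measure))"
      by (intro nn_integral_cong_AE) (auto simp: q(1) elim!: eventually_mono)
    then show "(\<integral>\<^sup>+ t. indicator ?Z (x(i := t)) \<partial>lborel) = 0"
      by simp
  qed
  finally have "emeasure (PiM (insert i I) ?M) ?Z = 0"
    by simp
  then show ?case
    using Z by (intro AE_I[of _ _ ?Z]) auto
qed

text \<open>Turns almost sure properties into an actual parameter vector. For \<open>I = {}\<close>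
  the total mass is \<open>1\<close>, otherwise infinite.\<close>

lemma not_AE_PiM_lborel_False:
  assumes "finite I"
  shows "\<not> (AE x in PiM I (\<lambda>_. lborel :: real measure). False)"
proof
  let ?M = "\<lambda>_. lborel :: real measure"
  interpret product_sigma_finite ?M
    by standard
  assume "AE x in PiM I ?M. False"
  then have "emeasure (PiM I ?M) (space (PiM I ?M)) = 0"
    by (simp add: AE_iff_measurable[OF _ refl])
  moreover have "emeasure (PiM I ?M) (space (PiM I ?M)) = (\<Prod>i\<in>I. emeasure lborel (UNIV :: real set))"
    unfolding space_PiM using assms by (subst emeasure_PiM) auto
  ultimately show False
    using assms by (simp add: emeasure_lborel_UNIV prod_zero_iff)
qed

section \<open>Generic independence of linked columns\<close>

text \<open>Used for the embedding \<open>to_fract\<close> and for evaluation of polynomials at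
  \<open>1\<close>.\<close>

lemma det_hom:
  fixes f :: "'a::comm_ring_1 \<Rightarrow> 'b::comm_ring_1" and M :: "'a ^ 'n ^ 'n::finite"
  assumes add: "\<And>x y. f (x + y) = f x + f y" and mult: "\<And>x y. f (x * y) = f x * f y" and one: "f 1 = 1"
  shows "f (det M) = det (\<chi> u v. f (M $ u $ v))"
proof -
  have zero: "f 0 = 0"
    using add[of 0 0] by simp
  have uminus: "f (- x) = - f x" for x
    using add[of x "- x"] zero by (simp add: add_eq_0_iff)
  have f_sum: "f (sum g S) = (\<Sum>s\<in>S. f (g s))" for g and S :: "('n \<Rightarrow> 'n) set"
    by (induction S rule: infinite_finite_induct) (simp_all add: zero add)
  have f_prod: "f (prod g S) = (\<Prod>s\<in>S. f (g s))" for g and S :: "'n set"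
    by (induction S rule: infinite_finite_induct) (simp_all add: one mult)
  have "f (of_int (sign p)) = of_int (sign p)" for p :: "'n \<Rightarrow> 'n"
    by (simp add: sign_def one uminus)
  then show ?thesis
    by (simp add: det_def f_sum f_prod mult)
qed

lemma det_nonzero_iff_kernel:
  fixes M :: "'a::field ^ 'n ^ 'n::finite"
  shows "det M \<noteq> 0 \<longleftrightarrow> (\<forall>y. M *v y = 0 \<longrightarrow> y = 0)"
  unfolding invertible_det_nz[symmetric] invertible_left_inverse matrix_left_invertible_ker ..

section \<open>Edge polynomials and the bordered matrix\<close>

lemma monic_poly_nonzero: "monic_poly n c \<noteq> 0"
proof -
  have "coeff (monic_poly n c) n = 1"
    by (simp add: monic_poly_def coeff_sum)
  then show ?thesis
    by auto
qed

text \<open>At \<open>z = 1\<close> every power of \<open>z\<close>, in particular the delay factor,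
  becomes \<open>1\<close>.\<close>

lemma poly_monic_poly_1: "poly (monic_poly n c) 1 = 1 + (\<Sum>m<n. c m)"
  by (simp add: monic_poly_def poly_sum poly_monom)

definition edge_num :: "('n \<times> 'n \<Rightarrow> nat) \<Rightarrow> ('n param \<Rightarrow> real) \<Rightarrow> 'n \<times> 'n \<Rightarrow> real poly" where
  "edge_num n P e = smult (P (Kappa e)) (monic_poly (n e) (\<lambda>m. P (Beta e m)))"

definition edge_den ::
    "('n \<times> 'n \<Rightarrow> nat) \<Rightarrow> ('n \<times> 'n \<Rightarrow> nat) \<Rightarrow> ('n param \<Rightarrow> real) \<Rightarrow> 'n \<times> 'n \<Rightarrow> real poly" where
  "edge_den d n P e = monom 1 (d e) * monic_poly (n e) (\<lambda>m. P (Alpha e m))"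

lemma edge_den_nonzero: "edge_den d n P e \<noteq> 0"
  by (simp add: edge_den_def monic_poly_nonzero monom_eq_0_iff)

lemma param_matrix_nth:
  "param_matrix E d n P $ u $ v =
     (if (v, u) \<in> E then to_fract (edge_num n P (v, u)) / to_fract (edge_den d n P (v, u)) else 0)"
  by (simp add: param_matrix_def edge_num_def edge_den_def Fract_conv_to_fract)

text \<open>
  The rows of \<open>I - G(P)\<close> outside \<open>A\<close>, cleared of denominators, completed by the unit rows that pick
  out the coordinates \<open>\<tau> a\<close>.
\<close>

definition bordered_matrix ::
    "('n \<times> 'n) set \<Rightarrow> ('n \<times> 'n \<Rightarrow> nat) \<Rightarrow> ('n \<times> 'n \<Rightarrow> nat) \<Rightarrow> 'n set \<Rightarrow> ('n \<Rightarrow> 'n) \<Rightarrow>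
      ('n param \<Rightarrow> real) \<Rightarrow> real poly ^ 'n ^ 'n" where
  "bordered_matrix E d n A \<tau> P = (\<chi> u v.
     if u \<in> A then (if v = \<tau> u then 1 else 0)
     else (if u = v then \<Prod>e\<in>E. edge_den d n P e else 0) -
       (if (v, u) \<in> E then edge_num n P (v, u) * (\<Prod>e\<in>E - {(v, u)}. edge_den d n P e) else 0))"

text \<open>The bordered matrix annihilates \<open>y\<close>: its rows in \<open>A\<close> read off
  coordinates in \<open>B\<close>, and its other rows are rows of \<open>I - G(P)\<close> times the
  common denominator \<open>D\<close>.\<close>

lemma independent_columns_if_bordered_matrix:
  fixes E :: "('n::finite \<times> 'n) set"
  assumes det: "det (bordered_matrix E d n A \<tau> P) \<noteq> 0" and \<tau>: "\<tau> ` A \<subseteq> B"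
  shows "independent_columns (mat 1 - param_matrix E d n P) A B"
  unfolding independent_columns_def
proof (intro allI impI, elim conjE)
  fix y assume yB: "\<forall>j\<in>B. y $ j = 0"
    and yA: "\<forall>u. u \<notin> A \<longrightarrow> ((mat 1 - param_matrix E d n P) *v y) $ u = 0"
  define D where "D = to_fract (\<Prod>e\<in>E. edge_den d n P e)"
  define S where "S = (\<chi> u v. to_fract (bordered_matrix E d n A \<tau> P $ u $ v))"
  have "to_fract (det (bordered_matrix E d n A \<tau> P)) = det S"
    unfolding S_def by (rule det_hom) simp_all
  then have "det S \<noteq> 0"
    using det by (metis to_fract_eq_0_iff)
  moreover have "(S *v y) $ u = 0" for u
  proof (cases "u \<in> A")
    case True
    have "(\<Sum>v\<in>UNIV. S $ u $ v * y $ v) = (\<Sum>v\<in>UNIV. if v = \<tau> u then y $ v else 0)"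
      using True by (intro sum.cong) (auto simp: S_def bordered_matrix_def)
    then have "(S *v y) $ u = y $ \<tau> u"
      by (simp add: matrix_vector_mult_def)
    then show ?thesis
      using yB \<tau> True by auto
  next
    case False
    have "S $ u $ v = D * (mat 1 - param_matrix E d n P) $ u $ v" for v
    proof (cases "(v, u) \<in> E")
      case True
      have "(\<Prod>e\<in>E. edge_den d n P e) = edge_den d n P (v, u) * (\<Prod>e\<in>E - {(v, u)}. edge_den d n P e)"
        using True by (intro prod.remove) simp_all
      then have "D * (to_fract (edge_num n P (v, u)) / to_fract (edge_den d n P (v, u))) =
          to_fract (edge_num n P (v, u) * (\<Prod>e\<in>E - {(v, u)}. edge_den d n P e))"
        unfolding D_def by (simp add: edge_den_nonzero)
      then show ?thesis
        using True False
        by (simp add: S_def bordered_matrix_def param_matrix_nth mat_def right_diff_distrib D_def)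
    next
      case notE: False
      then show ?thesis
        using False by (simp add: S_def bordered_matrix_def param_matrix_nth mat_def D_def)
    qed
    then have "(S *v y) $ u = D * ((mat 1 - param_matrix E d n P) *v y) $ u"
      by (simp add: matrix_vector_mult_def sum_distrib_left mult.assoc)
    then show ?thesis
      using yA False by simp
  qed
  ultimately show "y = 0"
    unfolding det_nonzero_iff_kernel by (simp add: vec_eq_iff)
qed

lemma poly_funs_if:
  "(c \<Longrightarrow> f \<in> poly_funs I) \<Longrightarrow> (\<not> c \<Longrightarrow> g \<in> poly_funs I) \<Longrightarrow> (\<lambda>x. if c then f x else g x) \<in> poly_funs I"
  by (cases c) simp_all

lemma param_indicesI:
  assumes "e \<in> E"
  shows "Kappa e \<in> param_indices E n"
    and "m < n e \<Longrightarrow> Alpha e m \<in> param_indices E n"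
    and "m < n e \<Longrightarrow> Beta e m \<in> param_indices E n"
  using assms unfolding param_indices_def by blast+

text \<open>Evaluation at \<open>1\<close> commutes with the determinant and makes the entries
  polynomial in the parameters.\<close>

lemma poly_funs_bordered_matrix:
  fixes E :: "('n::finite \<times> 'n) set"
  shows "(\<lambda>P. poly (det (bordered_matrix E d n A \<tau> P)) 1) \<in> poly_funs (param_indices E n)"
proof -
  have "poly (det M) 1 = det (\<chi> u v. poly (M $ u $ v) 1)" for M :: "real poly ^ 'n ^ 'n"
    by (rule det_hom) simp_all
  moreover have num: "(\<lambda>P. poly (edge_num n P e) 1) \<in> poly_funs (param_indices E n)" if "e \<in> E" for e
    unfolding edge_num_def poly_smult poly_monic_poly_1 using that
    by (intro poly_funs.mult poly_funs.add poly_funs.const poly_funs_sum poly_funs.coord)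
       (simp_all add: param_indicesI)
  moreover have den: "(\<lambda>P. poly (edge_den d n P e) 1) \<in> poly_funs (param_indices E n)" if "e \<in> E" for e
    unfolding edge_den_def poly_mult poly_monom poly_monic_poly_1 using that
    by (intro poly_funs.mult poly_funs.add poly_funs.const poly_funs_sum poly_funs.coord)
       (simp_all add: param_indicesI)
  have "(\<lambda>P. poly (bordered_matrix E d n A \<tau> P $ u $ v) 1) \<in> poly_funs (param_indices E n)" for u v
    unfolding bordered_matrix_def vec_lambda_beta if_distrib[of "\<lambda>p. poly p 1"]
      poly_diff poly_mult poly_prod poly_0 poly_1
    by (intro poly_funs_if poly_funs.const poly_funs_diff poly_funs.mult poly_funs_prod num den) auto
  ultimately show ?thesis
    by (simp add: poly_funs_det)
qed

text \<open>Supplies the point where the polynomial function above is nonzero; \<open>\<tau>\<close>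
  sends a start node to the end of its path.\<close>

lemma ex_bordered_matrix_nonsingular:
  fixes E :: "('n::finite \<times> 'n) set"
  assumes "linked E A B"
  obtains \<tau> P where "\<tau> ` A \<subseteq> B" "poly (det (bordered_matrix E d n A \<tau> P)) 1 \<noteq> 0"
proof -
  obtain p where p: "\<forall>a\<in>A. p a \<in> paths_between E {a} B"
    "\<forall>a\<in>A. \<forall>b\<in>A. a \<noteq> b \<longrightarrow> disjnt (set (p a)) (set (p b))"
    using assms unfolding linked_def by (elim exE conjE)
  define \<tau> where "\<tau> a = last (p a)" for a
  have path: "p a \<noteq> []" "distinct (p a)" "p a ! 0 = a" "\<tau> a \<in> B" if "a \<in> A" for a
    using p(1) that by (auto simp: paths_between_def digraph_path_def \<tau>_def hd_conv_nth[symmetric])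
  have edge: "(p a ! k, p a ! Suc k) \<in> E" if "a \<in> A" "Suc k < length (p a)" for a k
    using p(1) that by (auto simp: paths_between_def digraph_path_def successively_conv_nth)
  have unique: "a = b \<and> k = l"
    if "a \<in> A" "b \<in> A" "k < length (p a)" "l < length (p b)" "p a ! k = p b ! l" for a b k l
  proof -
    have "a = b"
      using p(2) that by (metis disjnt_iff nth_mem)
    then show ?thesis
      using that path(2) nth_eq_iff_index_eq by blast
  qed
  define S where "S = {(p a ! k, p a ! Suc k) |a k. a \<in> A \<and> Suc k < length (p a)}"
  have S: "S \<subseteq> E"
    using edge by (auto simp: S_def)
  \<comment> \<open>Gain \<open>1\<close> on the edges of the paths and \<open>0\<close> elsewhere: a kernel vector is constant along
    each path, where it vanishes at the end, and zero off the paths.\<close>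
  define P :: "'n param \<Rightarrow> real" where
    "P x = (case x of Kappa e \<Rightarrow> if e \<in> S then 1 else 0 | _ \<Rightarrow> 0)" for x
  \<comment> \<open>With all \<open>Alpha\<close> and \<open>Beta\<close> zero, the monic
    polynomials are powers of \<open>z\<close> and take the value \<open>1\<close>.\<close>
  have num: "poly (edge_num n P e) 1 = (if e \<in> S then 1 else 0)" for e
    by (simp add: edge_num_def poly_monic_poly_1 P_def)
  have den: "poly (edge_den d n P e) 1 = 1" for e
    by (simp add: edge_den_def poly_monic_poly_1 P_def poly_monom)
  define M where "M = (\<chi> u v. poly (bordered_matrix E d n A \<tau> P $ u $ v) 1)"
  have M: "M $ u $ v = (if u \<in> A then (if v = \<tau> u then 1 else 0)
      else (if u = v then 1 else 0) - (if (v, u) \<in> S then 1 else 0))" for u v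
    using S by (auto simp: M_def bordered_matrix_def num den poly_prod)
  have "y = 0" if "M *v y = 0" for y
  proof -
    have row: "(\<Sum>v\<in>UNIV. M $ u $ v * y $ v) = 0" for u
      using that by (simp add: matrix_vector_mult_def vec_eq_iff)
    have end_point: "y $ \<tau> u = 0" if "u \<in> A" for u
    proof -
      have "(\<Sum>v\<in>UNIV. M $ u $ v * y $ v) = (\<Sum>v\<in>UNIV. if v = \<tau> u then y $ v else 0)"
        using that by (intro sum.cong) (auto simp: M)
      then show ?thesis
        using row by simp
    qed
    have other: "y $ u = (\<Sum>v\<in>UNIV. if (v, u) \<in> S then y $ v else 0)" if "u \<notin> A" for u
    proof -
      have "(\<Sum>v\<in>UNIV. M $ u $ v * y $ v) =
          (\<Sum>v\<in>UNIV. (if u = v then y $ v else 0) - (if (v, u) \<in> S then y $ v else 0))"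
        using that by (intro sum.cong) (auto simp: M)
      then show ?thesis
        using row by (simp add: sum_subtractf)
    qed
    have along: "y $ (p a ! k) = y $ a" if "a \<in> A" "k < length (p a)" for a k
      using that(2)
    proof (induction k)
      case (Suc k)
      let ?u = "p a ! Suc k"
      have "?u \<notin> A"
        using unique[of a ?u "Suc k" 0] path(1,3) Suc.prems that(1) by force
      \<comment> \<open>By disjointness, exactly one selected edge enters a later node of a path, so
        its row equates two consecutive coordinates.\<close>
      moreover have "(v, ?u) \<in> S \<longleftrightarrow> v = p a ! k" for v
      proof
        assume "(v, ?u) \<in> S"
        then obtain b l where "b \<in> A" "Suc l < length (p b)" "v = p b ! l" "?u = p b ! Suc l"
          unfolding S_def by blast
        then show "v = p a ! k"
          using unique[of a b "Suc k" "Suc l"] that(1) Suc.prems by auto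
      next
        assume "v = p a ! k"
        then show "(v, ?u) \<in> S"
          using that(1) Suc.prems unfolding S_def by blast
      qed
      ultimately have "y $ ?u = y $ (p a ! k)"
        using other[of ?u] by simp
      then show ?case
        using Suc by simp
    qed (simp add: path that)
    have "y $ u = 0" for u
    proof (cases "\<exists>a\<in>A. u \<in> set (p a)")
      case True
      then obtain a k where a: "a \<in> A" "k < length (p a)" "u = p a ! k"
        by (metis in_set_conv_nth)
      have "\<tau> a = p a ! (length (p a) - 1)" "length (p a) - 1 < length (p a)"
        using path(1)[OF a(1)] by (simp_all add: \<tau>_def last_conv_nth)
      then show ?thesis
        using along[OF a(1)] a end_point[OF a(1)] by metis
    next
      case False
      have "u \<notin> A"
        using False path(1,3) by (metis length_greater_0_conv nth_mem)
      moreover have "(v, u) \<notin> S" for v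
        using False by (auto simp: S_def)
      ultimately show ?thesis
        using other by simp
    qed
    then show ?thesis
      by (simp add: vec_eq_iff)
  qed
  then have "det M \<noteq> 0"
    unfolding det_nonzero_iff_kernel by blast
  moreover have "poly (det (bordered_matrix E d n A \<tau> P)) 1 = det M"
    unfolding M_def by (rule det_hom) simp_all
  moreover have "\<tau> ` A \<subseteq> B"
    using path(4) by auto
  ultimately show ?thesis
    using that by metis
qed

lemma finite_param_indices:
  fixes E :: "('n::finite \<times> 'n) set"
  shows "finite (param_indices E n)"
proof -
  have "{Alpha e m |e m. e \<in> E \<and> m < n e} = (\<Union>e\<in>E. Alpha e ` {..<n e})"
    "{Beta e m |e m. e \<in> E \<and> m < n e} = (\<Union>e\<in>E. Beta e ` {..<n e})"
    by auto
  then show ?thesis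
    by (simp add: param_indices_def)
qed

text \<open>Generic converse of \<open>linked_if_independent_columns\<close>: a determinant with
  nonzero value at \<open>z = 1\<close> is nonzero.\<close>

lemma AE_independent_columns:
  fixes E :: "('n::finite \<times> 'n) set"
  assumes "linked E A B"
  shows "AE P in param_measure E n. independent_columns (mat 1 - param_matrix E d n P) A B"
proof -
  obtain \<tau> P where \<tau>: "\<tau> ` A \<subseteq> B" and P: "poly (det (bordered_matrix E d n A \<tau> P)) 1 \<noteq> 0"
    using ex_bordered_matrix_nonsingular[OF assms] by blast
  have "AE P in param_measure E n. poly (det (bordered_matrix E d n A \<tau> P)) 1 \<noteq> 0"
    unfolding param_measure_def
    by (rule AE_poly_funs_nonzero[OF finite_param_indices poly_funs_bordered_matrix P])
  then show ?thesis
    by (rule eventually_mono) (use independent_columns_if_bordered_matrix[OF _ \<tau>] in force)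
qed

section \<open>Identifiability\<close>

text \<open>Makes generic invertibility the case \<open>A = B = {}\<close> of
  \<open>AE_independent_columns\<close>.\<close>

lemma invertible_iff_independent_columns_empty: "invertible M \<longleftrightarrow> independent_columns M {} {}"
  unfolding invertible_left_inverse matrix_left_invertible_ker independent_columns_def
  by (simp add: vec_eq_iff)

lemma linked_empty: "linked E {} B"
  by (simp add: linked_def)

section \<open>Matrix inverses and networks with equal outputs\<close>

lemma
  fixes M :: "'a::field ^ 'n ^ 'n::finite"
  assumes "invertible M"
  shows matrix_inv_right: "M ** matrix_inv M = mat 1"
    and matrix_inv_left: "matrix_inv M ** M = mat 1"
  using someI_ex[OF assms[unfolded invertible_def]] by (simp_all add: matrix_inv_def)

lemma matrix_inv_unique:
  fixes M N :: "'a::field ^ 'n ^ 'n::finite"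
  assumes "N ** M = mat 1"
  shows "matrix_inv M = N"
proof -
  have "M ** N = mat 1"
    using assms by (simp add: matrix_left_right_inverse)
  then have "invertible M"
    using assms invertible_def by blast
  then have "matrix_inv M = (N ** M) ** matrix_inv M"
    using assms by simp
  also have "\<dots> = N"
    by (simp add: matrix_mul_assoc[symmetric] matrix_inv_right \<open>invertible M\<close>)
  finally show ?thesis .
qed

lemma selection_matrix_mult_eq_0_iff:
  fixes C :: "transfer_fun ^ 'n::finite ^ 'p::finite"
  assumes "selection_matrix C"
  shows "C *v y = 0 \<longleftrightarrow> (\<forall>j\<in>selected_nodes C. y $ j = 0)"
proof -
  have "\<exists>\<rho>. \<forall>k. C $ k = axis (\<rho> k) 1"
    using assms unfolding selection_matrix_def by metis
  then obtain \<rho> where \<rho>: "\<And>k. C $ k = axis (\<rho> k) 1"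
    by blast
  have "(\<Sum>j\<in>UNIV. C $ k $ j * y $ j) = (\<Sum>j\<in>UNIV. if j = \<rho> k then y $ j else 0)" for k
    by (intro sum.cong) (auto simp: \<rho> axis_def)
  then have "(C *v y) $ k = y $ \<rho> k" for k
    by (simp add: matrix_vector_mult_def)
  moreover have "selected_nodes C = range \<rho>"
    by (auto simp: selected_nodes_def \<rho> axis_def split: if_splits)
  ultimately show ?thesis
    by (simp add: vec_eq_iff)
qed

text \<open>Multiplying the common matrix \<open>C ** matrix_inv M\<close> by \<open>M\<close> and
  by \<open>M'\<close> gives \<open>C\<close> both times, so it annihilates the difference of their
  columns.\<close>

lemma same_output_column_diff:
  fixes M M' :: "'a::field ^ 'n ^ 'n::finite" and C :: "'a ^ 'n ^ 'p::finite" and i :: 'n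
  assumes M: "invertible M" and M': "invertible M'" and eq: "C ** matrix_inv M = C ** matrix_inv M'"
  defines "y \<equiv> matrix_inv M *v (column i M' - column i M)"
  shows "C *v y = 0" and "M *v y = column i M' - column i M"
proof -
  have "(C ** matrix_inv M) ** M' = C"
    unfolding eq by (simp add: matrix_mul_assoc[symmetric] matrix_inv_left M')
  moreover have "(C ** matrix_inv M) ** M = C"
    by (simp add: matrix_mul_assoc[symmetric] matrix_inv_left M)
  moreover have "(C ** matrix_inv M) *v column i N = column i (C ** matrix_inv M ** N)" for N
    by (simp add: column_def matrix_vector_mult_def matrix_matrix_mult_def vec_eq_iff)
  ultimately have "(C ** matrix_inv M) *v column i M' = (C ** matrix_inv M) *v column i M"
    by simp
  then show "C *v y = 0"
    by (simp add: y_def matrix_vector_mul_assoc matrix_vector_mult_diff_distrib)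
  show "M *v y = column i M' - column i M"
    by (simp add: y_def matrix_vector_mul_assoc matrix_inv_right M)
qed

text \<open>Put \<open>x = M *v y\<close>. Each \<open>j\<close> in \<open>N\<close> outside
  \<open>S \<union> R\<close> depends on \<open>R\<close>, so its entry of \<open>x\<close> can be
  cleared by a vector \<open>M *v w j\<close> that vanishes on \<open>S\<close>. What remains is
  supported on \<open>S \<union> R\<close>, hence zero.\<close>

lemma independent_columns_vanish:
  fixes M :: "'a::field ^ 'n ^ 'n::finite" and y :: "'a ^ 'n"
  assumes indep: "independent_columns M (S \<union> R) B" "S \<inter> R = {}"
    and dep: "\<And>j. j \<in> N - (S \<union> R) \<Longrightarrow> \<not> independent_columns M (insert j R) B"
    and y: "\<forall>j\<in>B. y $ j = 0" "\<And>u. u \<notin> S \<union> N \<Longrightarrow> (M *v y) $ u = 0"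
    and u: "u \<in> S"
    and R: "R \<subseteq> N"
  shows "(M *v y) $ u = 0"
proof -
  let ?J = "N - (S \<union> R)"
  have "\<exists>w. (\<forall>k\<in>B. w $ k = 0) \<and> (\<forall>u. u \<notin> insert j R \<longrightarrow> (M *v w) $ u = 0) \<and> (M *v w) $ j = 1"
    if j: "j \<in> ?J" for j
  proof -
    obtain w where w: "\<forall>k\<in>B. w $ k = 0" "\<forall>u. u \<notin> insert j R \<longrightarrow> (M *v w) $ u = 0" "w \<noteq> 0"
      using dep[OF j] unfolding independent_columns_def by blast
    let ?c = "(M *v w) $ j"
    \<comment> \<open>Otherwise \<open>w\<close> would be a nontrivial relation supported on
      \<open>R\<close> alone.\<close>
    have "?c \<noteq> 0"
      using indep(1) w unfolding independent_columns_def by (metis UnI2 insertE)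
    then show ?thesis
      using w by (intro exI[of _ "inverse ?c *s w"]) (simp add: vec.scale)
  qed
  then obtain w where w: "\<And>j. j \<in> ?J \<Longrightarrow> \<forall>k\<in>B. w j $ k = 0"
    "\<And>j u. j \<in> ?J \<Longrightarrow> u \<notin> insert j R \<Longrightarrow> (M *v w j) $ u = 0" "\<And>j. j \<in> ?J \<Longrightarrow> (M *v w j) $ j = 1"
    by metis
  define z where "z = y - (\<Sum>j\<in>?J. (M *v y) $ j *s w j)"
  have Mz: "(M *v z) $ u = (M *v y) $ u - (\<Sum>j\<in>?J. (M *v y) $ j * (M *v w j) $ u)" for u
    by (simp add: z_def vec.diff vec.sum vec.scale)
  have "(M *v z) $ u = 0" if u: "u \<notin> S \<union> R" for u
  proof -
    have "(\<Sum>j\<in>?J. (M *v y) $ j * (M *v w j) $ u) = (\<Sum>j\<in>?J. if j = u then (M *v y) $ u else 0)"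
      using w(2,3) u by (intro sum.cong refl) auto
    also have "\<dots> = (M *v y) $ u"
      using y(2) u by auto
    finally show ?thesis
      by (simp add: Mz)
  qed
  moreover have "\<forall>k\<in>B. z $ k = 0"
    using y(1) w(1) by (simp add: z_def)
  ultimately have "z = 0"
    using indep(1) unfolding independent_columns_def by blast
  then have "(M *v y) $ u = (\<Sum>j\<in>?J. (M *v y) $ j * (M *v w j) $ u)"
    using Mz[of u] by simp
  also have "\<dots> = 0"
  proof (intro sum.neutral ballI)
    fix j assume j: "j \<in> ?J"
    then have "u \<notin> insert j R"
      using u indep(2) by blast
    then show "(M *v y) $ j * (M *v w j) $ u = 0"
      by (simp add: w(2)[OF j])
  qed
  finally show ?thesis .
qed

lemma param_matrix_consistent: "(mat 1 - param_matrix E d n P) $ u $ v \<noteq> 0 \<Longrightarrow> u = v \<or> (v, u) \<in> E"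
  by (auto simp: param_matrix_def mat_def split: if_splits)

text \<open>By maximality of \<open>card R\<close>, adding a further out-neighbour outside
  \<open>S\<close> to \<open>R\<close> destroys linkedness, hence independence for every
  \<open>P\<close>; independence of \<open>S \<union> R\<close> holds for almost all
  \<open>P\<close>.\<close>

lemma generically_identifiable_if_linked:
  fixes E :: "('n::finite \<times> 'n) set" and C :: "transfer_fun ^ 'n ^ 'p::finite"
  assumes C: "selection_matrix C"
    and R: "R \<subseteq> E `` {i} - S" "card R = max_disjoint_paths E (E `` {i} - S) (selected_nodes C)"
    and linked: "linked E (S \<union> R) (selected_nodes C)"
  shows "generically_identifiable E C ({i} \<times> S)"
  unfolding generically_identifiable_def
proof (intro allI)
  fix d n
  let ?B = "selected_nodes C"
  let ?M = "\<lambda>P. mat 1 - param_matrix E d n P"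
  have unlinked: "\<not> linked E (insert j R) ?B" if "j \<in> E `` {i} - (S \<union> R)" for j
  proof
    assume "linked E (insert j R) ?B"
    moreover have "insert j R \<subseteq> E `` {i} - S"
      using that R(1) by blast
    ultimately have "card (insert j R) \<le> card R"
      using card_le_max_disjoint_paths R(2) by metis
    then show False
      using that by simp
  qed
  have "AE P in param_measure E n. independent_columns (?M P) {} {}"
    by (rule AE_independent_columns[OF linked_empty])
  moreover have "AE P in param_measure E n. independent_columns (?M P) (S \<union> R) ?B"
    by (rule AE_independent_columns[OF linked])
  ultimately show "AE P in param_measure E n. \<forall>G'. network_matrix G' \<and> consistent_with E G' \<and>
      C ** matrix_inv (?M P) = C ** matrix_inv (mat 1 - G') \<longrightarrow>
      (\<forall>(j, k)\<in>{i} \<times> S. param_matrix E d n P $ k $ j = G' $ k $ j)"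
  proof (eventually_elim, intro allI impI, elim conjE)
    fix P G'
    assume indep: "independent_columns (?M P) (S \<union> R) ?B" and "independent_columns (?M P) {} {}"
      and "network_matrix G'" and cons: "consistent_with E G'"
      and eq: "C ** matrix_inv (?M P) = C ** matrix_inv (mat 1 - G')"
    then have "invertible (?M P)" "invertible (mat 1 - G')"
      by (simp_all add: invertible_iff_independent_columns_empty network_matrix_def well_posed_def)
    from same_output_column_diff[OF this eq, of i] obtain y where
      y: "C *v y = 0" "?M P *v y = column i (mat 1 - G') - column i (?M P)"
      by blast
    have My: "(?M P *v y) $ k = param_matrix E d n P $ k $ i - G' $ k $ i" for k
      by (simp add: y(2) column_def)
    have "(?M P *v y) $ k = 0" if k: "k \<in> S" for k
    proof (rule independent_columns_vanish[OF indep _ _ _ _ k])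
      show "\<not> independent_columns (?M P) (insert j R) ?B" if "j \<in> E `` {i} - (S \<union> R)" for j
        using unlinked[OF that] linked_if_independent_columns param_matrix_consistent by metis
      show "\<forall>j\<in>?B. y $ j = 0"
        using y(1) selection_matrix_mult_eq_0_iff[OF C] by blast
      show "(?M P *v y) $ u = 0" if "u \<notin> S \<union> E `` {i}" for u
        unfolding My using that cons by (auto simp: consistent_with_def param_matrix_def)
    qed (use R in auto)
    then show "\<forall>(j, k)\<in>{i} \<times> S. param_matrix E d n P $ k $ j = G' $ k $ j"
      by (auto simp: My)
  qed
qed

section \<open>Constant networks\<close>

definition const_tf :: "real \<Rightarrow> transfer_fun" where
  "const_tf c = to_fract [:c:]"

lemma const_tf_simps:
  "const_tf 0 = 0" "const_tf 1 = 1" "const_tf (a + b) = const_tf a + const_tf b"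
  "const_tf (a - b) = const_tf a - const_tf b" "const_tf (a * b) = const_tf a * const_tf b"
  "const_tf a = const_tf b \<longleftrightarrow> a = b"
  by (simp_all add: const_tf_def flip: to_fract_add to_fract_diff to_fract_mult one_pCons)

lemma const_tf_sum: "const_tf (\<Sum>x\<in>X. f x) = (\<Sum>x\<in>X. const_tf (f x))"
  by (induction X rule: infinite_finite_induct) (simp_all add: const_tf_simps)

lemma proper_const_tf: "proper_tf (const_tf c)"
  unfolding proper_tf_def const_tf_def to_fract_def by (intro exI[of _ "[:c:]"] exI[of _ 1]) simp

lemma stable_const_tf: "stable_tf (const_tf c)"
  unfolding stable_tf_def const_tf_def to_fract_def by (intro exI[of _ "[:c:]"] exI[of _ 1]) simp

definition const_vec :: "real ^ 'n \<Rightarrow> transfer_fun ^ 'n" where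
  "const_vec x = (\<chi> u. const_tf (x $ u))"

definition const_mat :: "real ^ 'n ^ 'm \<Rightarrow> transfer_fun ^ 'n ^ 'm" where
  "const_mat M = (\<chi> u v. const_tf (M $ u $ v))"

lemma const_mat_mult: "const_mat (M ** N) = const_mat M ** const_mat N"
  by (simp add: const_mat_def matrix_matrix_mult_def vec_eq_iff const_tf_sum const_tf_simps)

lemma const_mat_vec: "const_mat M *v const_vec x = const_vec (M *v x)"
  by (simp add: const_mat_def const_vec_def matrix_vector_mult_def vec_eq_iff const_tf_sum const_tf_simps)

lemma const_mat_1: "const_mat (mat 1) = mat 1"
  by (simp add: const_mat_def mat_def vec_eq_iff const_tf_simps)

lemma const_mat_diff: "const_mat (M - N) = const_mat M - const_mat N"
  by (simp add: const_mat_def vec_eq_iff const_tf_simps)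

text \<open>The inverse of \<open>mat 1 - const_mat K\<close> is again constant, so its entries are
  proper and have no poles.\<close>

lemma network_matrix_const_mat:
  fixes K :: "real ^ 'n ^ 'n::finite"
  assumes "\<And>u. K $ u $ u = 0" "invertible (mat 1 - K)"
  shows "network_matrix (const_mat K)"
proof -
  let ?T = "matrix_inv (mat 1 - K)"
  have T: "const_mat ?T ** (mat 1 - const_mat K) = mat 1"
    using assms(2) by (simp add: matrix_inv_left flip: const_mat_1 const_mat_diff const_mat_mult)
  then have "invertible (mat 1 - const_mat K)"
    by (metis invertible_left_inverse)
  moreover have "matrix_inv (mat 1 - const_mat K) = const_mat ?T"
    by (rule matrix_inv_unique[OF T])
  ultimately show ?thesis
    using assms(1) unfolding network_matrix_def well_posed_def
    by (simp add: const_mat_def proper_const_tf stable_const_tf const_tf_simps)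
qed

text \<open>A relation over the reals is also one over the transfer functions.\<close>

lemma independent_columns_const_mat:
  assumes "independent_columns (const_mat M) A B"
  shows "independent_columns M A B"
  unfolding independent_columns_def
proof (intro allI impI, elim conjE)
  fix y assume "\<forall>j\<in>B. y $ j = 0" "\<forall>u. u \<notin> A \<longrightarrow> (M *v y) $ u = 0"
  then have "(\<forall>j\<in>B. const_vec y $ j = 0) \<and> (\<forall>u. u \<notin> A \<longrightarrow> (const_mat M *v const_vec y) $ u = 0)"
    unfolding const_mat_vec by (simp add: const_vec_def const_tf_simps)
  then have "const_vec y = 0"
    using assms unfolding independent_columns_def by blast
  then show "y = 0"
    by (simp add: const_vec_def vec_eq_iff flip: const_tf_simps)
qed

lemma param_matrix_constant:
  "param_matrix E (\<lambda>_. 0) (\<lambda>_. 0) P =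
    const_mat (\<chi> u v. if (v, u) \<in> E then P (Kappa (v, u)) else 0)"
  by (simp add: vec_eq_iff param_matrix_def const_mat_def const_tf_def to_fract_def monic_poly_def
      monom_0 flip: one_pCons Zero_fract_def)


text \<open>
  \<open>M'\<close> is \<open>M (I - \<epsilon> y e\<^sub>i\<^sup>T)\<close>, whose second factor does not change the output when
  \<open>C y = 0\<close>, and is invertible as long as \<open>\<epsilon> y\<^sub>i \<noteq> 1\<close>.
\<close>

lemma column_update_same_output:
  fixes M :: "'a::field ^ 'n ^ 'n::finite" and y :: "'a ^ 'n" and C :: "'a ^ 'n ^ 'p::finite"
  assumes M: "invertible M" and \<epsilon>: "\<epsilon> * y $ i \<noteq> 1"
    and M': "M' = (\<chi> u v. M $ u $ v - (if v = i then \<epsilon> * (M *v y) $ u else 0))"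
    and C: "C *v y = 0"
  shows "invertible M'" and "C ** matrix_inv M = C ** matrix_inv M'"
proof -
  have M'_mult: "M' *v z = M *v (z - (\<epsilon> * z $ i) *s y)" for z
  proof -
    have "(M' *v z) $ u = (M *v z) $ u - (\<Sum>v\<in>UNIV. if v = i then \<epsilon> * (M *v y) $ u * z $ v else 0)" for u
      unfolding matrix_vector_mult_def M' sum_subtractf[symmetric] vec_lambda_beta
      by (intro sum.cong) (auto simp: left_diff_distrib)
    then show ?thesis
      by (simp add: vec_eq_iff vec.diff vec.scale)
  qed
  have "z = 0" if "M' *v z = 0" for z
  proof -
    \<comment> \<open>Cancelling \<open>M\<close> makes \<open>z\<close> a multiple of
      \<open>y\<close>; its \<open>i\<close>-th component then forces
      \<open>z $ i = 0\<close>.\<close>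
    have "z - (\<epsilon> * z $ i) *s y = matrix_inv M *v (M *v (z - (\<epsilon> * z $ i) *s y))"
      by (simp add: matrix_vector_mul_assoc matrix_inv_left M)
    then have z: "z = (\<epsilon> * z $ i) *s y"
      using that by (simp add: M'_mult)
    then have "z $ i = \<epsilon> * z $ i * y $ i"
      by (metis vector_smult_component)
    then have "z $ i * (1 - \<epsilon> * y $ i) = 0"
      by (simp add: algebra_simps)
    then show ?thesis
      using z \<epsilon> by simp
  qed
  then show inv: "invertible M'"
    by (simp add: invertible_left_inverse matrix_left_invertible_ker)
  have "(C ** matrix_inv M ** M') *v z = C *v z" for z
  proof -
    have "(C ** matrix_inv M ** M') *v z = (C ** (matrix_inv M ** M)) *v (z - (\<epsilon> * z $ i) *s y)"
      by (simp add: M'_mult flip: matrix_vector_mul_assoc)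
    also have "\<dots> = C *v z"
      by (simp add: matrix_inv_left M vec.diff vec.scale C)
    finally show ?thesis .
  qed
  then have "C ** matrix_inv M ** M' = C"
    by (simp add: matrix_eq)
  then have "C ** matrix_inv M' = C ** matrix_inv M ** (M' ** matrix_inv M')"
    by (simp add: matrix_mul_assoc)
  then show "C ** matrix_inv M = C ** matrix_inv M'"
    by (simp add: matrix_inv_right inv)
qed

text \<open>If \<open>S \<union> R\<close> is not linked, its columns satisfy a relation. It
  involves \<open>S\<close> because \<open>R\<close> is generically independent, and adding it to
  column \<open>i\<close> alters an edge into \<open>S\<close> but not the output.\<close>

lemma linked_if_generically_identifiable:
  fixes E :: "('n::finite \<times> 'n) set" and C :: "transfer_fun ^ 'n ^ 'p::finite"
  assumes "irrefl E" and C: "selection_matrix C"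
    and ident: "generically_identifiable E C ({i} \<times> S)"
    and sub: "S \<union> R \<subseteq> E `` {i}" and R: "linked E R (selected_nodes C)"
  shows "linked E (S \<union> R) (selected_nodes C)"
proof (rule ccontr)
  let ?B = "selected_nodes C"
  assume unlinked: "\<not> ?thesis"
  let ?\<mu> = "param_measure E (\<lambda>_. 0)"
  let ?G = "param_matrix E (\<lambda>_. 0) (\<lambda>_. 0)"
  let ?Q = "\<lambda>P. \<forall>G'. network_matrix G' \<and> consistent_with E G' \<and>
      C ** matrix_inv (mat 1 - ?G P) = C ** matrix_inv (mat 1 - G') \<longrightarrow>
      (\<forall>(j, k)\<in>{i} \<times> S. ?G P $ k $ j = G' $ k $ j)"
  have "\<exists>P. ?Q P \<and> independent_columns (mat 1 - ?G P) {} {} \<and> independent_columns (mat 1 - ?G P) R ?B"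
  proof (rule ccontr)
    assume none: "\<not> ?thesis"
    have "AE P in ?\<mu>. ?Q P"
      using ident unfolding generically_identifiable_def by blast
    moreover have "AE P in ?\<mu>. independent_columns (mat 1 - ?G P) {} {}"
      by (rule AE_independent_columns[OF linked_empty])
    moreover have "AE P in ?\<mu>. independent_columns (mat 1 - ?G P) R ?B"
      by (rule AE_independent_columns[OF R])
    ultimately have "AE P in ?\<mu>. False"
      by eventually_elim (use none in blast)
    then show False
      using not_AE_PiM_lborel_False[OF finite_param_indices] unfolding param_measure_def by blast
  qed
  then obtain P where P: "?Q P" "independent_columns (mat 1 - ?G P) {} {}"
    "independent_columns (mat 1 - ?G P) R ?B"
    by blast
  define K where "K = (\<chi> u v. if (v, u) \<in> E then P (Kappa (v, u)) else 0)"
  define M where "M = mat 1 - K"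
  have G: "?G P = const_mat K" "mat 1 - ?G P = const_mat M"
    by (simp_all add: param_matrix_constant K_def M_def const_mat_diff const_mat_1)
  have invM: "invertible (const_mat M)"
    using P(2) by (simp only: G(2) invertible_iff_independent_columns_empty)
  \<comment> \<open>Working with the real matrix gives a real relation \<open>y\<close>, so the
    perturbed network stays constant.\<close>
  have "\<not> independent_columns M (S \<union> R) ?B"
  proof
    assume "independent_columns M (S \<union> R) ?B"
    moreover have "M $ u $ v \<noteq> 0 \<Longrightarrow> u = v \<or> (v, u) \<in> E" for u v
      by (auto simp: M_def K_def mat_def split: if_splits)
    ultimately show False
      using linked_if_independent_columns unlinked by blast
  qed
  then obtain y where y: "\<forall>j\<in>?B. y $ j = 0" "\<And>u. u \<notin> S \<union> R \<Longrightarrow> (M *v y) $ u = 0" "y \<noteq> 0"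
    unfolding independent_columns_def by blast
  obtain k where k: "k \<in> S" "(M *v y) $ k \<noteq> 0"
    using independent_columns_const_mat[of M R ?B] P(3) y unfolding G(2) independent_columns_def
    by (metis UnE)
  \<comment> \<open>Any nonzero value with \<open>\<epsilon> * y $ i \<noteq> 1\<close> would do;
    this keeps the perturbed matrix invertible.\<close>
  define \<epsilon> :: real where "\<epsilon> = (if y $ i = 1 then 2 else 1)"
  have \<epsilon>: "\<epsilon> \<noteq> 0" "\<epsilon> * y $ i \<noteq> 1"
    by (auto simp: \<epsilon>_def)
  define K' where "K' = (\<chi> u v. K $ u $ v + (if v = i then \<epsilon> * (M *v y) $ u else 0))"
  have M': "const_mat (mat 1 - K') = (\<chi> u v. const_mat M $ u $ v -
      (if v = i then const_tf \<epsilon> * (const_mat M *v const_vec y) $ u else 0))"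
    unfolding const_mat_vec
    by (simp add: vec_eq_iff K'_def M_def const_mat_def const_vec_def const_tf_simps)
  have \<epsilon>': "const_tf \<epsilon> * const_vec y $ i \<noteq> 1"
    using \<epsilon>(2) by (simp add: const_vec_def flip: const_tf_simps)
  have Cy: "C *v const_vec y = 0"
    using y(1) by (simp add: selection_matrix_mult_eq_0_iff[OF C] const_vec_def const_tf_simps)
  note update = column_update_same_output[OF invM \<epsilon>' M' Cy]
  \<comment> \<open>The perturbation touches only edges leaving \<open>i\<close>; without self-loops
    the diagonal stays zero.\<close>
  have supp: "(i, u) \<in> E" if "(M *v y) $ u \<noteq> 0" for u
    using y(2) that sub by blast
  have "invertible (mat 1 - K')"
    using update(1) independent_columns_const_mat
    unfolding invertible_iff_independent_columns_empty by blast
  moreover have "K' $ u $ u = 0" for u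
    using assms(1) supp[of u] by (auto simp: K'_def K_def irrefl_def)
  ultimately have "network_matrix (const_mat K')"
    by (intro network_matrix_const_mat)
  moreover have "(v, u) \<in> E" if "K' $ u $ v \<noteq> 0" for u v
    using that supp[of u] by (auto simp: K'_def K_def split: if_splits)
  then have "consistent_with E (const_mat K')"
    using const_tf_simps(1) unfolding consistent_with_def const_mat_def by force
  moreover have "C ** matrix_inv (mat 1 - ?G P) = C ** matrix_inv (mat 1 - const_mat K')"
    using update(2) unfolding G(2) by (simp add: const_mat_diff const_mat_1)
  ultimately have "?G P $ k $ i = const_mat K' $ k $ i"
    using P(1) k(1) by blast
  then have "K $ k $ i = K' $ k $ i"
    by (simp add: G(1) const_mat_def const_tf_simps)
  then show False
    using k \<epsilon>(1) by (simp add: K'_def)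
qed

theorem theoremV1:
  fixes E :: "('n::finite \<times> 'n) set"
    and C :: "transfer_fun ^ 'n ^ 'p::finite"
    and i :: 'n and Nstar :: "'n set"
  assumes "irrefl E"
    and "weakly_connected E"
    and "selection_matrix C"
    and "Nstar \<subseteq> E `` {i}"
  shows "generically_identifiable E C ({i} \<times> Nstar) \<longleftrightarrow>
    max_disjoint_paths E Nstar (selected_nodes C) = card Nstar \<and>
    max_disjoint_paths E (E `` {i}) (selected_nodes C) =
      max_disjoint_paths E Nstar (selected_nodes C)
        + max_disjoint_paths E (E `` {i} - Nstar) (selected_nodes C) \<and>
    max_disjoint_paths E Nstar (selected_nodes C)
        + max_disjoint_paths E (E `` {i} - Nstar) (selected_nodes C) =
      card Nstar + max_disjoint_paths E (E `` {i} - Nstar) (selected_nodes C)"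
    (is "?ident \<longleftrightarrow> ?paths")
proof
  assume ident: ?ident
  \<comment> \<open>A largest linked set of the remaining out-neighbours, to which identifiability
    allows \<open>Nstar\<close> to be added.\<close>
  obtain R where R: "R \<subseteq> E `` {i} - Nstar" "linked E R (selected_nodes C)"
    "card R = max_disjoint_paths E (E `` {i} - Nstar) (selected_nodes C)"
    by (rule ex_linked_card_eq_max_disjoint_paths)
  have "linked E (Nstar \<union> R) (selected_nodes C)"
    using assms R by (intro linked_if_generically_identifiable[OF assms(1,3) ident]) auto
  from max_disjoint_paths_of_linked_extension[OF assms(4) R(1,3) this] show ?paths
    by simp
next
  assume ?paths
  then have "max_disjoint_paths E (E `` {i}) (selected_nodes C) =
      card Nstar + max_disjoint_paths E (E `` {i} - Nstar) (selected_nodes C)"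
    by simp
  then obtain R where "R \<subseteq> E `` {i} - Nstar"
    "card R = max_disjoint_paths E (E `` {i} - Nstar) (selected_nodes C)"
    "linked E (Nstar \<union> R) (selected_nodes C)"
    by (rule ex_linked_extension[OF assms(4)])
  then show ?ident
    using assms by (intro generically_identifiable_if_linked)
qed

end
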